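(* Let $U=\{x_1,\dots,x_n\}$ be a finite set of discrete variables, where $x_i$ takes $r_i\ge 2$ values, and let $D$ be a database with $N\ge 10$ cases over $U$. Let $B_S$ be a network structure over $U$ with at least one parent-set containing $\log_2 N$ variables or more. If no prior information is available (that is, the prior probability $P(\cdot)$ is equal for all network structures over $U$), then there exists a network structure $B_{S'}$ over $U$ such that $L(B_{S'},D)>L(B_S,D)$, where $L$ is the MDL measure.
   Context: A network structure over $U$ is a directed acyclic graph with node set $U$; the parent-set $\pi_i$ of $x_i$ is the set of its parents. A database $D$ with $N$ cases is a list of $N$ complete instantiations of $U$ (no missing values). For a network structure $B_S$, let $v_{i1},\dots,v_{ir_i}$ be the values of $x_i$ and $w_{i1},\dots,w_{iq_i}$ the instantiations of $\pi_i$ (one empty instantiation if $\pi_i=\emptyset$; instantiations not occurring in $D$ contribute nothing to the sum defining $H$ below). Let $N_{ijk}$ be the number of cases in $D$ with $x_i=v_{ik}$ and $\pi_i=w_{ij}$, and $N_{ij}=\sum_{k=1}^{r_i} N_{ijk}$. Logarithms are to base 2, and terms with $N_{ijk}=0$ are taken as $0$. The MDL measure is $$L(B_S,D)=\log P(B_S)-N\,H(B_S,D)-\tfrac12\,\kappa\log N,$$ where $P(B_S)$ is the prior probability of $B_S$, $H(B_S,D)=\sum_{i=1}^n\sum_{j=1}^{q_i}\sum_{k=1}^{r_i}-\frac{N_{ijk}}{N}\log\frac{N_{ijk}}{N_{ij}}$ and $\kappa=\sum_{i=1}^n(r_i-1)\prod_{x_j\in\pi_i}r_j$ (an empty product being $1$).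 *)

theory Defs
  imports "HOL-Library.FuncSet" "HOL-Probability.Probability_Mass_Function"
begin

text \<open>
  Throughout, \<open>U\<close> is the set of variables and \<open>V x\<close> is the set of values of the variable \<open>x\<close>.
  An instantiation of a set \<open>A\<close> of variables is an element of \<open>Pi\<^sub>E A V\<close>; being extensional
  functions, instantiations of \<open>A\<close> are determined by their values on \<open>A\<close>, and the empty
  set has exactly one instantiation.
\<close>

text \<open>A directed graph on the node set \<open>U\<close> is given by its set of arcs, with
  \<open>(y, x) \<in> B\<close> an arc from \<open>y\<close> to \<open>x\<close>.\<close>

definition network_structure :: "'v set \<Rightarrow> 'v rel \<Rightarrow> bool" where
  "network_structure U B \<longleftrightarrow> B \<subseteq> U \<times> U \<and> acyclic B"

definition parents :: "'v rel \<Rightarrow> 'v \<Rightarrow> 'v set" where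
  "parents B x = {y. (y, x) \<in> B}"

definition database :: "'v set \<Rightarrow> ('v \<Rightarrow> 'a set) \<Rightarrow> ('v \<Rightarrow> 'a) list \<Rightarrow> bool" where
  "database U V D \<longleftrightarrow> set D \<subseteq> Pi\<^sub>E U V"

text \<open>The counts $N_{ijk}$ and $N_{ij}$, for the variable \<open>x\<close> $= x_i$, the parent instantiation
  \<open>w\<close> $= w_{ij}$ and the value \<open>v\<close> $= v_{ik}$.\<close>

definition count_val :: "'v rel \<Rightarrow> ('v \<Rightarrow> 'a) list \<Rightarrow> 'v \<Rightarrow> ('v \<Rightarrow> 'a) \<Rightarrow> 'a \<Rightarrow> nat" where
  "count_val B D x w v = length (filter (\<lambda>c. c x = v \<and> restrict c (parents B x) = w) D)"

definition count_inst ::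
  "('v \<Rightarrow> 'a set) \<Rightarrow> 'v rel \<Rightarrow> ('v \<Rightarrow> 'a) list \<Rightarrow> 'v \<Rightarrow> ('v \<Rightarrow> 'a) \<Rightarrow> nat" where
  "count_inst V B D x w = (\<Sum>v\<in>V x. count_val B D x w v)"

text \<open>The terms with $N_{ijk} = 0$ vanish because of the factor $N_{ijk}/N$, whatever the value
  of the logarithm; this covers the instantiations that do not occur in \<open>D\<close>.\<close>

definition mdl_entropy ::
  "'v set \<Rightarrow> ('v \<Rightarrow> 'a set) \<Rightarrow> 'v rel \<Rightarrow> ('v \<Rightarrow> 'a) list \<Rightarrow> real" where
  "mdl_entropy U V B D =
     (\<Sum>x\<in>U. \<Sum>w\<in>Pi\<^sub>E (parents B x) V. \<Sum>v\<in>V x.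
        - (real (count_val B D x w v) / real (length D))
          * log 2 (real (count_val B D x w v) / real (count_inst V B D x w)))"

definition mdl_params :: "'v set \<Rightarrow> ('v \<Rightarrow> 'a set) \<Rightarrow> 'v rel \<Rightarrow> real" where
  "mdl_params U V B =
     (\<Sum>x\<in>U. (real (card (V x)) - 1) * (\<Prod>y\<in>parents B x. real (card (V y))))"

text \<open>\<open>P\<close> is the prior distribution on network structures.\<close>

definition mdl ::
  "'v rel pmf \<Rightarrow> 'v set \<Rightarrow> ('v \<Rightarrow> 'a set) \<Rightarrow> 'v rel \<Rightarrow> ('v \<Rightarrow> 'a) list \<Rightarrow> real" where
  "mdl P U V B D =
     log 2 (pmf P B) - real (length D) * mdl_entropy U V B D
       - 1 / 2 * mdl_params U V B * log 2 (real (length D))"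

end

theory Submission
  imports Defs
begin

text \<open>Delete all arcs into a variable \<open>x\<close> with at least $\log_2 N$ parents. The likelihood part
  of the score drops by at most $N \log_2 r \le N (r - 1)$, the maximal empirical entropy of a
  variable with $r$ values. The number of parameters of \<open>x\<close> shrinks from at least
  $(r - 1) \cdot 2^{\log_2 N} = (r - 1) N$ to $r - 1$, so the penalty part gains at least
  $\frac12 (r - 1) (N - 1) \log_2 N$, which exceeds $N (r - 1)$ as soon as $N \ge 8$.\<close>

definition var_entropy ::
  "('v \<Rightarrow> 'a set) \<Rightarrow> 'v rel \<Rightarrow> ('v \<Rightarrow> 'a) list \<Rightarrow> 'v \<Rightarrow> real" where
  "var_entropy V B D x =
     (\<Sum>w\<in>Pi\<^sub>E (parents B x) V. \<Sum>v\<in>V x.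
        - (real (count_val B D x w v) / real (length D))
          * log 2 (real (count_val B D x w v) / real (count_inst V B D x w)))"

definition var_params :: "('v \<Rightarrow> 'a set) \<Rightarrow> 'v rel \<Rightarrow> 'v \<Rightarrow> real" where
  "var_params V B x = (real (card (V x)) - 1) * (\<Prod>y\<in>parents B x. real (card (V y)))"

text \<open>The sign is opposite to that of \<open>mdl\<close>: apart from the prior term, the score
  is minus the sum of these costs, so cheaper is better.\<close>

definition var_cost ::
  "('v \<Rightarrow> 'a set) \<Rightarrow> 'v rel \<Rightarrow> ('v \<Rightarrow> 'a) list \<Rightarrow> 'v \<Rightarrow> real" where
  "var_cost V B D x =
     real (length D) * var_entropy V B D x
       + 1 / 2 * var_params V B x * log 2 (real (length D))"

lemma mdl_eq_sum_var_cost: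
  "mdl P U V B D = log 2 (pmf P B) - (\<Sum>x\<in>U. var_cost V B D x)"
  by (simp add: mdl_def mdl_entropy_def mdl_params_def var_cost_def var_entropy_def
      var_params_def sum.distrib sum_distrib_left sum_distrib_right)

text \<open>Locality of the score: counts and parameters at \<open>x\<close> see the graph only
  through the parents of \<open>x\<close>, so two graphs need comparing only where parent sets
  differ.\<close>

lemma var_cost_cong:
  assumes "parents B x = parents B' x"
  shows "var_cost V B D x = var_cost V B' D x"
  using assms
  by (simp add: var_cost_def var_entropy_def var_params_def count_inst_def count_val_def)

lemma sum_length_filter_eq:
  assumes "finite A" and "\<forall>c\<in>set D. f c \<in> A"
  shows "(\<Sum>v\<in>A. length (filter (\<lambda>c. f c = v) D)) = length D"
  using assms(2)
proof (induction D)
  case (Cons c D)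
  have "(\<Sum>v\<in>A. length (filter (\<lambda>c. f c = v) (c # D)))
      = (\<Sum>v\<in>A. (if v = f c then 1 else 0) + length (filter (\<lambda>c. f c = v) D))"
    by (intro sum.cong) auto
  also have "\<dots> = length (c # D)"
    using Cons assms(1) by (simp add: sum.distrib sum.delta)
  finally show ?case .
qed simp

text \<open>Gibbs' inequality against the uniform distribution: bound each term by the tangent
  \<open>ln t \<le> t - 1\<close> at \<open>t = 1 / (r * p v)\<close>, then sum.\<close>

lemma entropy_le_log_card:
  fixes p :: "'a \<Rightarrow> real"
  assumes "finite A" and "\<And>v. v \<in> A \<Longrightarrow> 0 \<le> p v" and "sum p A = 1"
  shows "(\<Sum>v\<in>A. - p v * log 2 (p v)) \<le> log 2 (real (card A))"
proof -
  define r where "r = real (card A)"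
  have "A \<noteq> {}" using assms(3) by auto
  then have r: "r > 0" using assms(1) by (simp add: r_def card_gt_0_iff)
  have le: "- p v * ln (p v) \<le> p v * ln r + (1 / r - p v)" if "v \<in> A" for v
  proof (cases "p v = 0")
    case False
    then have p: "p v > 0" using assms(2)[OF that] by simp
    have "p v * ln (1 / (r * p v)) \<le> p v * (1 / (r * p v) - 1)"
      using p r by (intro mult_left_mono ln_le_minus_one) auto
    then show ?thesis using p r by (simp add: ln_div ln_mult algebra_simps)
  qed (use r in simp)
  \<comment> \<open>The corrections \<open>1 / r - p v\<close> sum to \<open>1 - 1 = 0\<close>,
    which leaves \<open>ln r\<close>.\<close>
  have "(\<Sum>v\<in>A. - p v * ln (p v)) \<le> (\<Sum>v\<in>A. p v * ln r + (1 / r - p v))"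
    by (intro sum_mono le)
  also have "\<dots> = ln r"
    using assms(3) r
    by (simp add: sum.distrib sum_subtractf sum_distrib_right[symmetric] r_def[symmetric])
  finally have "(\<Sum>v\<in>A. - p v * ln (p v)) / ln 2 \<le> ln r / ln 2"
    by (intro divide_right_mono) auto
  then show ?thesis
    by (simp add: log_def sum_divide_distrib r_def)
qed

text \<open>Follows from \<open>n < 2 ^ n\<close> at \<open>n = r - 1\<close>. It turns the entropy
  bound into a multiple of the factor \<open>r - 1\<close> that also occurs in the parameter
  count.\<close>

lemma log2_le_minus_one:
  assumes "1 \<le> (r::nat)"
  shows "log 2 (real r) \<le> real r - 1"
proof -
  have "r \<le> 2 ^ (r - 1)" using assms less_exp[of "r - 1"] by linarith
  then have "real r \<le> 2 ^ (r - 1)" by (metis of_nat_le_iff of_nat_numeral of_nat_power)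
  then have "log 2 (real r) \<le> real (r - 1)" using assms by (intro log2_of_power_le) auto
  then show ?thesis using assms by simp
qed

text \<open>A value count is at most the count of its parent instantiation, so the logarithm of a
  nonzero ratio is at most 0; a zero count annihilates its term.\<close>

lemma var_entropy_nonneg:
  assumes "finite (V x)"
  shows "0 \<le> var_entropy V B D x"
  unfolding var_entropy_def
proof (intro sum_nonneg)
  fix w v assume v: "v \<in> V x"
  let ?n = "count_val B D x w v" and ?m = "count_inst V B D x w"
  have le: "?n \<le> ?m"
    unfolding count_inst_def using assms v by (intro member_le_sum) auto
  show "0 \<le> - (real ?n / real (length D)) * log 2 (real ?n / real ?m)"
  proof (cases "?n = 0")
    case False
    then have "log 2 (real ?n / real ?m) \<le> 0" using le by simp
    then show ?thesis by (intro mult_nonpos_nonpos) auto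
  qed simp
qed

lemma var_entropy_no_parents_le:
  assumes "finite (V x)" and "\<forall>c\<in>set D. c x \<in> V x" and "D \<noteq> []" and "parents B x = {}"
  shows "var_entropy V B D x \<le> log 2 (real (card (V x)))"
proof -
  define n where "n v = length (filter (\<lambda>c. c x = v) D)" for v
  \<comment> \<open>The constant \<open>undefined\<close> function is the only instantiation of the
    empty parent set, so the entropy is that of the empirical distribution of
    \<open>x\<close>.\<close>
  have cv: "count_val B D x (\<lambda>_. undefined) v = n v" for v
    using assms(4) by (simp add: count_val_def n_def restrict_def)
  have tot: "(\<Sum>v\<in>V x. n v) = length D"
    unfolding n_def by (rule sum_length_filter_eq) (use assms in auto)
  have "(\<Sum>v\<in>V x. real (n v) / real (length D)) = real (\<Sum>v\<in>V x. n v) / real (length D)"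
    by (simp add: sum_divide_distrib)
  also have "\<dots> = 1" using tot assms(3) by simp
  finally have "(\<Sum>v\<in>V x. - (real (n v) / real (length D)) * log 2 (real (n v) / real (length D)))
      \<le> log 2 (real (card (V x)))"
    using assms(1) by (intro entropy_le_log_card) auto
  then show ?thesis
    using assms(4) tot by (simp add: var_entropy_def count_inst_def cv)
qed

text \<open>Every parent contributes a factor of at least 2 to the product.\<close>

lemma var_params_ge:
  assumes "finite (parents B x)" and "\<And>y. y \<in> parents B x \<Longrightarrow> 2 \<le> card (V y)"
    and "1 \<le> card (V x)"
  shows "(real (card (V x)) - 1) * 2 ^ card (parents B x) \<le> var_params V B x"
proof -
  have "(\<Prod>y\<in>parents B x. 2) \<le> (\<Prod>y\<in>parents B x. real (card (V y)))"
    using assms(2) by (intro prod_mono) force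
  then show ?thesis
    using assms(3) by (auto simp: var_params_def intro: mult_left_mono)
qed

theorem theorem3p3:
  fixes U :: "'v set" and V :: "'v \<Rightarrow> 'a set" and D :: "('v \<Rightarrow> 'a) list"
    and P :: "'v rel pmf" and B :: "'v rel"
  assumes "finite U"
    and "\<And>x. x \<in> U \<Longrightarrow> finite (V x) \<and> 2 \<le> card (V x)"
    and "database U V D"
    and "10 \<le> length D"
    and "network_structure U B"
    and "\<exists>x\<in>U. log 2 (real (length D)) \<le> real (card (parents B x))"
    and "set_pmf P \<subseteq> {B. network_structure U B}"
    and "\<And>B1 B2. network_structure U B1 \<Longrightarrow> network_structure U B2 \<Longrightarrow> pmf P B1 = pmf P B2"
  shows "\<exists>B'. network_structure U B' \<and> mdl P U V B' D > mdl P U V B D"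
proof -
  obtain x where x: "x \<in> U" and many: "log 2 (real (length D)) \<le> real (card (parents B x))"
    using assms(6) by blast
  define B' where "B' = {e \<in> B. snd e \<noteq> x}"
  define N where "N = real (length D)"
  define r where "r = real (card (V x))"
  have N: "10 \<le> N" using assms(4) by (simp add: N_def)
  have card_pos: "1 \<le> card (V x)" using assms(2)[OF x] by linarith
  have r: "2 \<le> r" using assms(2)[OF x] by (simp add: r_def)
  have sub: "B' \<subseteq> B" by (auto simp: B'_def)
  then have net: "network_structure U B'"
    using assms(5) by (auto simp: network_structure_def intro: acyclic_subset)
  have par_x: "parents B' x = {}"
    by (auto simp: parents_def B'_def)
  have par_other: "parents B' y = parents B y" if "y \<noteq> x" for y
    using that by (auto simp: parents_def B'_def)
  have par_sub: "parents B x \<subseteq> U"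
    using assms(5) by (auto simp: parents_def network_structure_def)

  \<comment> \<open>The constant comes from \<open>2 ^ 3 = 8\<close> and
    \<open>8 \<le> N\<close>.\<close>
  have log_N: "3 \<le> log 2 N"
    using N by (simp add: le_log_iff)
  have "N \<le> 2 ^ card (parents B x)"
    using many N by (simp add: N_def[symmetric] log_le_iff powr_realpow)
  then have "(r - 1) * N \<le> (r - 1) * 2 ^ card (parents B x)"
    using r by (intro mult_left_mono) auto
  also have "\<dots> \<le> var_params V B x"
    unfolding r_def
    using par_sub assms(1,2) card_pos by (intro var_params_ge) (blast intro: finite_subset)+
  finally have params: "(r - 1) * N \<le> var_params V B x" .
  have ent: "0 \<le> var_entropy V B D x"
    using assms(2)[OF x] by (intro var_entropy_nonneg) auto
  have "\<forall>c\<in>set D. c x \<in> V x"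
    using assms(3) x by (auto simp: database_def)
  then have "var_entropy V B' D x \<le> log 2 r"
    unfolding r_def using assms(2)[OF x] assms(4) par_x
    by (intro var_entropy_no_parents_le) auto
  also have "\<dots> \<le> r - 1"
    unfolding r_def using card_pos by (rule log2_le_minus_one)
  finally have ent': "var_entropy V B' D x \<le> r - 1" .

  \<comment> \<open>Without parents the product is empty, so \<open>x\<close> has exactly
    \<open>r - 1\<close> parameters in \<open>B'\<close>.\<close>
  have "var_cost V B' D x \<le> N * (r - 1) + 1 / 2 * (r - 1) * log 2 N"
    using ent' N par_x by (simp add: var_cost_def var_params_def N_def r_def mult_left_mono)
  also have "\<dots> < 1 / 2 * ((r - 1) * N) * log 2 N"
  proof -
    \<comment> \<open>The next inequality amounts to \<open>2 * N < log 2 N * (N - 1)\<close>, and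
      \<open>2 * N < 3 * (N - 1)\<close> holds as \<open>N > 3\<close>.\<close>
    have "3 * (N - 1) \<le> log 2 N * (N - 1)"
      using log_N N by (intro mult_right_mono) auto
    then have "N + 1 / 2 * log 2 N < 1 / 2 * N * log 2 N"
      using N by (simp add: algebra_simps)
    then have "(r - 1) * (N + 1 / 2 * log 2 N) < (r - 1) * (1 / 2 * N * log 2 N)"
      using r by (intro mult_strict_left_mono) auto
    then show ?thesis by (simp add: algebra_simps)
  qed
  also have "\<dots> \<le> 1 / 2 * var_params V B x * log 2 N"
    using params log_N by (intro mult_right_mono mult_left_mono) auto
  also have "\<dots> \<le> var_cost V B D x"
    using ent by (simp add: var_cost_def N_def)
  finally have less: "var_cost V B' D x < var_cost V B D x" .

  have "(\<Sum>y\<in>U. var_cost V B' D y) < (\<Sum>y\<in>U. var_cost V B D y)"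
  proof (rule sum_strict_mono_ex1)
    show "\<forall>y\<in>U. var_cost V B' D y \<le> var_cost V B D y"
      using less var_cost_cong[OF par_other] by (metis order.refl less_imp_le)
    show "\<exists>y\<in>U. var_cost V B' D y < var_cost V B D y"
      using less x by blast
  qed (fact assms(1))
  \<comment> \<open>Equal priors make the terms \<open>log 2 (pmf P _)\<close> cancel, leaving the
    comparison of costs.\<close>
  then have "mdl P U V B D < mdl P U V B' D"
    using assms(8)[OF net assms(5)] by (simp add: mdl_eq_sum_var_cost)
  then show ?thesis using net by blast
qed

end
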